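(* Let $f(X)=a_nX^n+\cdots+a_1X+a_0$ be a polynomial with real coefficients of degree $n\ge 1$ with $a_n>0$, having $s\ge 1$ sign changes between consecutive non-zero coefficients. Let $k=\lfloor \frac{s}{2}\rfloor+1$ and, for $1\le j\le k$, let $$v_j=\max\left\{1,\ \max_{n_j\le i\le N_j}\left(\frac{S_j^-}{S_j^+}\right)^{\frac{1}{p_j-i}}\right\},$$ where $p_j,n_j,N_j,S_j^+,S_j^-$ are the quantities attached to the sign pattern of $f$ defined in the context. Then $f$ has no zeros in the sector $S_{v,\frac{\pi}{n}}$ with $v=\max\{v_1,\dots,v_{\lfloor s/2\rfloor+1}\}$.
   Context: For real numbers $v,\theta$ with $0<\theta\le\pi$, define the open sector $S_{v,\theta}=\{z=v+\rho e^{i\varphi}\in\mathbb{C}:\rho>0,\ |\varphi|<\theta\}$ (with $\varphi$ real). Sign pattern. List the non-zero coefficients of $f$ in order of decreasing index and partition this list into maximal runs of consecutive (in the list) coefficients of the same sign. Since $a_n>0$, the first run is positive, and runs alternate in sign; there are $s+1$ runs. The $j$-th positive run consists of the non-zero coefficients with indices between $p_j$ and $P_j$, where $P_j$ is its largest and $p_j$ its smallest index; the $j$-th negative run consists of the non-zero coefficients with indices between $n_j$ and $N_j$, where $N_j$ is its largest and $n_j$ its smallest index. Thus $n=P_1\ge p_1>N_1\ge n_1>P_2\ge p_2>N_2\ge n_2>\cdots$. Put $S_j^+=\sum_{p_j\le i\le P_j}|a_i|$ and $S_j^-=\sum_{n_j\le i\le N_j}|a_i|$. With $k=\lfloor s/2\rfloor+1$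 there are $k$ positive runs; there are $k$ negative runs if $s$ is odd and $k-1$ if $s$ is even. If $s$ is even (no $k$-th negative run), one sets $S_k^-=0$ and the inner maximum defining $v_k$ is omitted, so $v_k=1$. *)

theory Defs
  imports "HOL-Analysis.Analysis" "HOL-Computational_Algebra.Polynomial"
begin

definition sector :: "real \<Rightarrow> real \<Rightarrow> complex set" where
  "sector v \<theta> = {z. \<exists>\<rho> \<phi> :: real. \<rho> > 0 \<and> \<bar>\<phi>\<bar> < \<theta> \<and>
     z = complex_of_real v + complex_of_real \<rho> * exp (\<i> * complex_of_real \<phi>)}"

definition nz_indices :: "real poly \<Rightarrow> nat list" where
  "nz_indices f = filter (\<lambda>i. coeff f i \<noteq> 0) (rev [0..<Suc (degree f)])"

definition sign_changes :: "real poly \<Rightarrow> nat" where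
  "sign_changes f = card {m. Suc m < length (nz_indices f) \<and>
     coeff f (nz_indices f ! m) * coeff f (nz_indices f ! Suc m) < 0}"

text \<open>Splits a list of indices into its maximal blocks of consecutive entries at which
  \<open>a\<close> has the same sign.\<close>

function split_runs :: "(nat \<Rightarrow> real) \<Rightarrow> nat list \<Rightarrow> nat list list" where
  "split_runs a [] = []"
| "split_runs a (i # xs) =
     (i # takeWhile (\<lambda>l. sgn (a l) = sgn (a i)) xs) #
     split_runs a (dropWhile (\<lambda>l. sgn (a l) = sgn (a i)) xs)"
  by pat_completeness auto
termination
  by (relation "Wellfounded.measure (\<lambda>(a, xs). length xs)") (auto simp: le_imp_less_Suc length_dropWhile_le)

definition pos_runs :: "real poly \<Rightarrow> nat list list" where
  "pos_runs f = filter (\<lambda>r. coeff f (hd r) > 0) (split_runs (coeff f) (nz_indices f))"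

definition neg_runs :: "real poly \<Rightarrow> nat list list" where
  "neg_runs f = filter (\<lambda>r. coeff f (hd r) < 0) (split_runs (coeff f) (nz_indices f))"

text \<open>Runs are numbered from 1 in the mathematics, whereas list positions start at 0.
  The quantities \<open>P\<^sub>j\<close>, \<open>p\<^sub>j\<close>, \<open>N\<^sub>j\<close>, \<open>n\<^sub>j\<close> are, in this order:\<close>

definition pos_hi :: "real poly \<Rightarrow> nat \<Rightarrow> nat" where
  "pos_hi f j = Max (set (pos_runs f ! (j - 1)))"

definition pos_lo :: "real poly \<Rightarrow> nat \<Rightarrow> nat" where
  "pos_lo f j = Min (set (pos_runs f ! (j - 1)))"

definition neg_hi :: "real poly \<Rightarrow> nat \<Rightarrow> nat" where
  "neg_hi f j = Max (set (neg_runs f ! (j - 1)))"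

definition neg_lo :: "real poly \<Rightarrow> nat \<Rightarrow> nat" where
  "neg_lo f j = Min (set (neg_runs f ! (j - 1)))"

definition pos_sum :: "real poly \<Rightarrow> nat \<Rightarrow> real" where
  "pos_sum f j = (\<Sum>i = pos_lo f j..pos_hi f j. \<bar>coeff f i\<bar>)"

text \<open>If the number of sign changes is even, the last positive run is not followed by a
  negative run; this is the case \<open>j > length (neg_runs f)\<close> below.\<close>

definition neg_sum :: "real poly \<Rightarrow> nat \<Rightarrow> real" where
  "neg_sum f j =
     (if j \<le> length (neg_runs f) then \<Sum>i = neg_lo f j..neg_hi f j. \<bar>coeff f i\<bar> else 0)"

definition run_bound :: "real poly \<Rightarrow> nat \<Rightarrow> real" where
  "run_bound f j =
     (if j \<le> length (neg_runs f)
      then max 1 (Max ((\<lambda>i. (neg_sum f j / pos_sum f j) powr (1 / (real (pos_lo f j) - real i)))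
                       ` {neg_lo f j..neg_hi f j}))
      else 1)"

end

theory Submission
  imports Defs
begin

text \<open>Write \<open>f (v + w) = \<Sum>\<^sub>m b\<^sub>m w\<^sup>m\<close>. Pairing each positive run with the negative run following it,
  the definition of \<open>v\<close> makes the contribution of every pair to every \<open>b\<^sub>m\<close> nonnegative, while
  \<open>b\<^sub>n = a\<^sub>n > 0\<close>. For \<open>w = \<rho> exp (\<i>\<phi>)\<close> with \<open>0 < \<bar>\<phi>\<bar> < \<pi> / n\<close>, all \<open>sin (m\<phi>)\<close> with \<open>1 \<le> m \<le> n\<close>
  are nonzero and have the sign of \<open>\<phi>\<close>, so the imaginary part of \<open>f (v + w)\<close> does not vanish.\<close>

section \<open>Polynomials with nonnegative coefficients on a sector\<close>

text \<open>By De Moivre the m-th term has imaginary part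
  \<open>b m * \<rho> ^ m * sin (m * \<phi>)\<close>. For m \<le> n the angle stays between 0 and
  pi, so no term is negative, and the term m = n is strictly positive.\<close>

lemma sector_sum_nonzero_upper:
  fixes b :: "nat \<Rightarrow> real"
  assumes b: "\<And>m. b m \<ge> 0" "b n > 0" and n: "n \<ge> 1" and \<rho>: "\<rho> > 0" and \<phi>: "0 < \<phi>" "\<phi> < pi / real n"
  shows "Im (\<Sum>m\<le>n. complex_of_real (b m) * (complex_of_real \<rho> * exp (\<i> * complex_of_real \<phi>)) ^ m) > 0"
proof -
  have "Im (\<Sum>m\<le>n. complex_of_real (b m) * (complex_of_real \<rho> * exp (\<i> * complex_of_real \<phi>)) ^ m)
      = (\<Sum>m\<le>n. b m * (\<rho> ^ m * sin (real m * \<phi>)))"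
  proof (subst Im_sum, intro sum.cong refl)
    fix m
    have "(complex_of_real \<rho> * exp (\<i> * complex_of_real \<phi>)) ^ m = complex_of_real (\<rho> ^ m) * cis (real m * \<phi>)"
      by (simp add: power_mult_distrib cis_conv_exp[symmetric] Complex.DeMoivre)
    then show "Im (complex_of_real (b m) * (complex_of_real \<rho> * exp (\<i> * complex_of_real \<phi>)) ^ m)
        = b m * (\<rho> ^ m * sin (real m * \<phi>))"
      by (simp del: of_real_power)
  qed
  also have "\<dots> > 0"
  proof (rule sum_pos2[where i = n])
    have n\<phi>: "real n * \<phi> < pi"
      using \<phi> n by (simp add: field_simps)
    then show "0 < b n * (\<rho> ^ n * sin (real n * \<phi>))"
      using b \<rho> \<phi> n by (intro mult_pos_pos zero_less_power sin_gt_zero) auto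
    fix m assume "m \<in> {..n}"
    then have "real m * \<phi> \<le> real n * \<phi>"
      using \<phi> by (intro mult_right_mono) auto
    with n\<phi> have "real m * \<phi> \<le> pi" by linarith
    then show "0 \<le> b m * (\<rho> ^ m * sin (real m * \<phi>))"
      using b \<rho> \<phi> by (intro mult_nonneg_nonneg zero_le_power sin_ge_zero) auto
  qed auto
  finally show ?thesis .
qed

text \<open>On the ray \<phi> = 0 imaginary parts carry no information, but there the sum is real
  and positive. Negative angles reduce to positive ones by conjugation, the coefficients being
  real.\<close>

lemma sector_sum_nonzero:
  fixes b :: "nat \<Rightarrow> real"
  assumes b: "\<And>m. b m \<ge> 0" "b n > 0" and n: "n \<ge> 1" and \<rho>: "\<rho> > 0" and \<phi>: "\<bar>\<phi>\<bar> < pi / real n"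
  shows "(\<Sum>m\<le>n. complex_of_real (b m) * (complex_of_real \<rho> * exp (\<i> * complex_of_real \<phi>)) ^ m) \<noteq> 0"
    (is "?S \<phi> \<noteq> 0")
proof -
  consider "\<phi> = 0" | "\<phi> > 0" | "\<phi> < 0" by linarith
  then show ?thesis
  proof cases
    case 1
    have "(\<Sum>m\<le>n. b m * \<rho> ^ m) > 0"
      using b \<rho> by (intro sum_pos2[where i = n]) auto
    moreover have "?S \<phi> = complex_of_real (\<Sum>m\<le>n. b m * \<rho> ^ m)"
      using 1 by simp
    ultimately show ?thesis
      by (simp only: of_real_eq_0_iff)
  next
    case 2
    then have "Im (?S \<phi>) > 0"
      using b n \<rho> \<phi> by (intro sector_sum_nonzero_upper) auto
    then show ?thesis by force
  next
    case 3
    have "?S \<phi> = cnj (?S (- \<phi>))"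
      by (simp add: exp_cnj)
    moreover have "Im (?S (- \<phi>)) > 0"
      using b n \<rho> \<phi> 3 by (intro sector_sum_nonzero_upper) auto
    ultimately show ?thesis
      by (metis complex_cnj_zero_iff less_irrefl zero_complex.sel(2))
  qed
qed

section \<open>Taylor expansion at a real centre\<close>

lemma poly_of_real_offset:
  fixes f :: "real poly" and v :: real and w :: complex
  shows "poly (map_poly complex_of_real f) (complex_of_real v + w)
    = (\<Sum>m\<le>degree f. complex_of_real
        (\<Sum>i\<le>degree f. coeff f i * (real (i choose m) * v ^ (i - m))) * w ^ m)"
proof -
  \<comment> \<open>Binomial coefficients vanish for m > i, so the range of m can be taken
    independent of \<open>i\<close>, which permits the interchange of sums below. They also make the
    truncated exponent \<open>i - m\<close> harmless.\<close>
  have *: "(complex_of_real v + w) ^ i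
      = (\<Sum>m\<le>degree f. of_nat (i choose m) * complex_of_real v ^ (i - m) * w ^ m)"
    if "i \<le> degree f" for i
  proof -
    have "(complex_of_real v + w) ^ i = (\<Sum>m\<le>i. of_nat (i choose m) * w ^ m * complex_of_real v ^ (i - m))"
      by (subst add.commute) (rule binomial_ring)
    also have "\<dots> = (\<Sum>m\<le>degree f. of_nat (i choose m) * w ^ m * complex_of_real v ^ (i - m))"
      using that by (intro sum.mono_neutral_left) (auto simp: binomial_eq_0)
    finally show ?thesis by (simp add: mult_ac)
  qed
  have "poly (map_poly complex_of_real f) (complex_of_real v + w)
      = (\<Sum>i\<le>degree f. complex_of_real (coeff f i) * (complex_of_real v + w) ^ i)"
    by (simp add: poly_altdef degree_map_poly coeff_map_poly)
  also have "\<dots> = (\<Sum>i\<le>degree f. \<Sum>m\<le>degree f. complex_of_real (coeff f i) *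
      (of_nat (i choose m) * complex_of_real v ^ (i - m) * w ^ m))"
    by (intro sum.cong refl) (simp add: * sum_distrib_left)
  also have "\<dots> = (\<Sum>m\<le>degree f. \<Sum>i\<le>degree f. complex_of_real (coeff f i) *
      (of_nat (i choose m) * complex_of_real v ^ (i - m) * w ^ m))"
    by (rule sum.swap)
  finally show ?thesis
    by (simp add: sum_distrib_left sum_distrib_right mult_ac)
qed

section \<open>A positive run dominates the following negative run\<close>

lemma taylor_weight_mono:
  fixes v :: real
  assumes "v \<ge> 1" "i \<le> j"
  shows "real (i choose m) * v ^ (i - m) \<le> real (j choose m) * v ^ (j - m)"
  using assms by (intro mult_mono power_increasing) (auto intro: binomial_right_mono)

text \<open>All comparisons pass through p = \<open>Min A\<close>. The bound on \<open>v\<close>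
  gives \<open>Sn * c j \<le> Sp * c p\<close> for each \<open>j\<close> in \<open>B\<close>;
  averaging over \<open>B\<close> with weights \<open>\<bar>a j\<bar>\<close> and using that
  \<open>c\<close> increases on \<open>A\<close> from its value at \<open>p\<close> gives the
  claim.\<close>

lemma block_nonneg:
  fixes a :: "nat \<Rightarrow> real" and v :: real
  assumes fin: "finite A" "finite B" "A \<noteq> {}" "B \<noteq> {}"
    and pos: "\<And>i. i \<in> A \<Longrightarrow> a i > 0" and neg: "\<And>i. i \<in> B \<Longrightarrow> a i < 0"
    and less: "\<And>i j. i \<in> A \<Longrightarrow> j \<in> B \<Longrightarrow> j < i"
    and v: "v \<ge> 1"
    and bound: "\<And>j. j \<in> B \<Longrightarrow>
      ((\<Sum>i\<in>B. \<bar>a i\<bar>) / (\<Sum>i\<in>A. \<bar>a i\<bar>)) powr (1 / (real (Min A) - real j)) \<le> v"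
  shows "(\<Sum>i\<in>A. a i * (real (i choose m) * v ^ (i - m))) +
         (\<Sum>i\<in>B. a i * (real (i choose m) * v ^ (i - m))) \<ge> 0"
proof -
  define c where "c i = real (i choose m) * v ^ (i - m)" for i
  define p where "p = Min A"
  define Sp where "Sp = (\<Sum>i\<in>A. \<bar>a i\<bar>)"
  define Sn where "Sn = (\<Sum>i\<in>B. \<bar>a i\<bar>)"
  have p: "p \<in> A" unfolding p_def using fin by auto
  have Sp: "Sp > 0" unfolding Sp_def using fin pos by (intro sum_pos) force+
  have Sn: "Sn > 0" unfolding Sn_def using fin neg by (intro sum_pos) force+
  have c_nonneg: "c i \<ge> 0" for i unfolding c_def using v by simp
  have key: "Sn * c j \<le> Sp * c p" if j: "j \<in> B" for j
  proof (cases "m \<le> j")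
    case False
    then have "c j = 0" by (simp add: c_def)
    then show ?thesis using Sp c_nonneg[of p] by simp
  next
    case True
    have jp: "j < p" using less p j by blast
    \<comment> \<open>The exponents \<open>1 / (p - j)\<close> and \<open>p - j\<close> cancel,
      which turns the hypothesis on \<open>v\<close> into
      \<open>Sn / Sp \<le> v ^ (p - j)\<close>.\<close>
    have "Sn / Sp = ((Sn / Sp) powr (1 / (real p - real j))) powr (real (p - j))"
      using Sn Sp jp by (simp add: powr_powr of_nat_diff)
    also have "\<dots> \<le> v powr (real (p - j))"
      using bound[OF j] by (intro powr_mono2) (auto simp: Sn_def Sp_def p_def)
    also have "\<dots> = v ^ (p - j)"
      using v by (simp add: powr_realpow)
    finally have ratio: "Sn \<le> Sp * v ^ (p - j)"
      using Sp by (simp add: field_simps)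
    have "Sn * c j \<le> Sp * v ^ (p - j) * c j"
      using ratio c_nonneg by (rule mult_right_mono)
    \<comment> \<open>Since m \<le> j < p, the truncated differences add up exactly: (p - j) + (j -
      m) = p - m.\<close>
    also have "\<dots> = Sp * (real (j choose m) * v ^ (p - m))"
      using True jp by (simp add: c_def power_add[symmetric])
    also have "\<dots> \<le> Sp * c p"
      unfolding c_def using Sp v jp
      by (intro mult_left_mono mult_right_mono) (auto intro: binomial_right_mono)
    finally show ?thesis .
  qed
  have "Sn * (\<Sum>i\<in>B. \<bar>a i\<bar> * c i) = (\<Sum>i\<in>B. \<bar>a i\<bar> * (Sn * c i))"
    by (simp add: sum_distrib_left mult_ac)
  also have "\<dots> \<le> (\<Sum>i\<in>B. \<bar>a i\<bar> * (Sp * c p))"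
    by (intro sum_mono mult_left_mono key) auto
  \<comment> \<open>Both sides equal \<open>Sn * Sp * c p\<close>: summing the weights over
    \<open>B\<close> yields \<open>Sn\<close>, and \<open>Sp\<close> is expanded again as a sum over
    \<open>A\<close>.\<close>
  also have "\<dots> = Sn * (\<Sum>i\<in>A. \<bar>a i\<bar> * c p)"
    by (simp add: Sn_def Sp_def sum_distrib_right[symmetric])
  also have "\<dots> \<le> Sn * (\<Sum>i\<in>A. \<bar>a i\<bar> * c i)"
    using Sn fin v unfolding c_def p_def
    by (intro mult_left_mono sum_mono taylor_weight_mono) auto
  finally have "(\<Sum>i\<in>B. \<bar>a i\<bar> * c i) \<le> (\<Sum>i\<in>A. \<bar>a i\<bar> * c i)"
    using Sn by simp
  moreover have "(\<Sum>i\<in>B. \<bar>a i\<bar> * c i) = - (\<Sum>i\<in>B. a i * c i)"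
    using neg by (simp add: sum_negf[symmetric] abs_of_neg)
  moreover have "(\<Sum>i\<in>A. \<bar>a i\<bar> * c i) = (\<Sum>i\<in>A. a i * c i)"
    using pos by (intro sum.cong) (auto simp: abs_of_pos)
  ultimately show ?thesis by (simp add: c_def)
qed

section \<open>Runs of equal sign\<close>

lemma concat_split_runs: "concat (split_runs a xs) = xs"
  by (induction a xs rule: split_runs.induct) auto

lemma split_runs_nonempty: "r \<in> set (split_runs a xs) \<Longrightarrow> r \<noteq> []"
  by (induction a xs rule: split_runs.induct) auto

lemma split_runs_same_sgn:
  "r \<in> set (split_runs a xs) \<Longrightarrow> i \<in> set r \<Longrightarrow> sgn (a i) = sgn (a (hd r))"
  by (induction a xs rule: split_runs.induct) (auto dest: set_takeWhileD)

lemma split_runs_alternate: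
  "successively (\<lambda>r r'. sgn (a (hd r)) \<noteq> sgn (a (hd r'))) (split_runs a xs)"
proof (induction a xs rule: split_runs.induct)
  case (2 a i xs)
  let ?ys = "dropWhile (\<lambda>l. sgn (a l) = sgn (a i)) xs"
  show ?case
  proof (cases ?ys)
    case (Cons y ys)
    \<comment> \<open>The next run starts at the first entry rejected by the predicate that
      collected the current run.\<close>
    then have "sgn (a y) \<noteq> sgn (a i)"
      using hd_dropWhile[of "\<lambda>l. sgn (a l) = sgn (a i)" xs] by simp
    then show ?thesis using 2 Cons by (simp add: successively_Cons)
  next
    case Nil
    then show ?thesis by (simp del: dropWhile_eq_Nil_conv)
  qed
qed simp

text \<open>A new first entry either extends the run of \<open>y\<close> or opens its own. This
  supplies a recursion by single entries where \<open>split_runs\<close> itself recurses by whole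
  runs.\<close>

lemma length_split_runs_Cons_Cons:
  "length (split_runs a (x # y # zs)) =
     (if sgn (a x) = sgn (a y) then 0 else 1) + length (split_runs a (y # zs))"
  by simp

text \<open>Sign changes are exactly the boundaries between runs, and there is one run more than
  boundaries.\<close>

lemma length_split_runs:
  fixes a :: "nat \<Rightarrow> real"
  assumes "xs \<noteq> []" "\<And>i. i \<in> set xs \<Longrightarrow> a i \<noteq> 0"
  shows "length (split_runs a xs) =
    Suc (card {m. Suc m < length xs \<and> a (xs ! m) * a (xs ! Suc m) < 0})"
  using assms
proof (induction xs rule: induct_list012)
  case (3 x y zs)
  let ?M = "\<lambda>xs. {m. Suc m < length xs \<and> a (xs ! m) * a (xs ! Suc m) < 0}"
  have fin: "finite (?M xs)" for xs
    by (rule finite_subset[of _ "{..length xs}"]) auto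
  \<comment> \<open>\<open>Z\<close> records a possible sign change between \<open>x\<close> and
    \<open>y\<close>, at position 0; \<open>W\<close> holds those of the tail, whose positions shift
    by one.\<close>
  define Z where "Z = {m::nat. m = 0 \<and> a x * a y < 0}"
  define W where "W = ?M (y # zs)"
  have Z: "finite Z" "Z \<inter> Suc ` W = {}"
    unfolding Z_def by (auto intro: finite_subset[of _ "{0}"])
  have W: "finite W"
    unfolding W_def by (rule fin)
  have "?M (x # y # zs) = Z \<union> Suc ` W"
  proof (intro set_eqI)
    fix m show "m \<in> ?M (x # y # zs) \<longleftrightarrow> m \<in> Z \<union> Suc ` W"
      by (cases m) (auto simp: Z_def W_def)
  qed
  then have "card (?M (x # y # zs)) = card Z + card W"
    using Z W by (simp only: card_Un_disjoint finite_imageI card_image[OF inj_Suc])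
  moreover have "a x \<noteq> 0" "a y \<noteq> 0"
    using 3(4) by auto
  \<comment> \<open>For non-zero reals, different signs amount to a negative product.\<close>
  then have "card Z = (if sgn (a x) = sgn (a y) then 0 else 1)"
    unfolding Z_def by (cases "a x > 0"; cases "a y > 0") (simp_all add: mult_less_0_iff)
  moreover have "length (split_runs a (y # zs)) = Suc (card W)"
    unfolding W_def by (rule 3(2)) (use 3(4) in simp_all)
  ultimately show ?case
    by (simp only: length_split_runs_Cons_Cons add_Suc_right)
qed auto

lemma sorted_wrt_concatD:
  "sorted_wrt P (concat rs) \<Longrightarrow> sorted_wrt (\<lambda>r r'. \<forall>i\<in>set r. \<forall>j\<in>set r'. P i j) rs"
  by (induction rs) (auto simp: sorted_wrt_append)

text \<open>Entries are removed two at a time: in an alternating list starting with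
  \<open>P\<close>, the j-th entry satisfying \<open>P\<close> is directly followed by the j-th
  entry violating it, if there is one.\<close>

lemma filter_alternating:
  assumes "successively (\<lambda>x y. P x \<noteq> P y) xs" "xs \<noteq> [] \<Longrightarrow> P (hd xs)" "sorted_wrt R xs"
  shows "length (filter (\<lambda>x. \<not> P x) xs) \<le> length (filter P xs) \<and>
    (\<forall>j < length (filter (\<lambda>x. \<not> P x) xs). R (filter P xs ! j) (filter (\<lambda>x. \<not> P x) xs ! j))"
  using assms
proof (induction xs rule: induct_list012)
  case (3 x y zs)
  then have xy: "P x" "\<not> P y" by auto
  have "successively (\<lambda>x y. P x \<noteq> P y) zs" "zs \<noteq> [] \<Longrightarrow> P (hd zs)"
    using 3(3) xy by (auto simp: successively_Cons)
  moreover have "sorted_wrt R zs" "R x y" using 3(5) by auto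
  ultimately show ?case
    using 3(1) xy by (auto simp: nth_Cons split: nat.split)
qed auto

section \<open>Nonnegativity of the Taylor coefficients\<close>

lemma set_nz_indices: "set (nz_indices f) = {i. coeff f i \<noteq> 0}"
  by (auto simp: nz_indices_def less_Suc_eq_le dest: le_degree)

lemma sorted_nz_indices: "sorted_wrt (>) (nz_indices f)"
  unfolding nz_indices_def by (intro sorted_wrt_filter) (simp add: sorted_wrt_rev sorted_wrt_upt del: upt_Suc)

lemma distinct_nz_indices: "distinct (nz_indices f)"
  by (simp add: nz_indices_def)

lemma nz_indices_Cons:
  assumes "f \<noteq> 0"
  shows "\<exists>xs. nz_indices f = degree f # xs"
  using assms by (simp add: nz_indices_def)

lemma sum_list_filter_split:
  fixes F :: "'a \<Rightarrow> 'b :: comm_monoid_add"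
  shows "(\<Sum>x\<leftarrow>xs. F x) = (\<Sum>x\<leftarrow>filter P xs. F x) + (\<Sum>x\<leftarrow>filter (\<lambda>x. \<not> P x) xs. F x)"
  by (induction xs) (auto simp: ac_simps)

lemma coeff_hd_run_nonzero:
  assumes r: "r \<in> set (split_runs (coeff f) (nz_indices f))"
  shows "coeff f (hd r) \<noteq> 0"
proof -
  have "hd r \<in> set (concat (split_runs (coeff f) (nz_indices f)))"
    using hd_in_set[OF split_runs_nonempty[OF r]] r by auto
  then show ?thesis
    by (simp add: concat_split_runs set_nz_indices)
qed

text \<open>Writing the negative runs by the complementary predicate lets the facts on splitting a
  list by \<open>P\<close> and its negation apply.\<close>

lemma neg_runs_alt:
  "neg_runs f = filter (\<lambda>r. \<not> coeff f (hd r) > 0) (split_runs (coeff f) (nz_indices f))"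
  unfolding neg_runs_def by (intro filter_cong refl) (use coeff_hd_run_nonzero in force)

lemma sorted_split_runs_nz_indices:
  "sorted_wrt (\<lambda>r r'. \<forall>i\<in>set r. \<forall>j\<in>set r'. i > j) (split_runs (coeff f) (nz_indices f))"
  by (rule sorted_wrt_concatD) (simp add: concat_split_runs sorted_nz_indices)

text \<open>The positive leading coefficient makes the first run positive, so the runs, listed by
  decreasing index, form an alternating list as in \<open>filter_alternating\<close>.\<close>

lemma pos_neg_runs_alternate:
  assumes "coeff f (degree f) > 0"
  shows "length (neg_runs f) \<le> length (pos_runs f)"
    and "\<And>j p q. j < length (neg_runs f) \<Longrightarrow> p \<in> set (pos_runs f ! j) \<Longrightarrow> q \<in> set (neg_runs f ! j) \<Longrightarrow> q < p"
proof -
  let ?rs = "split_runs (coeff f) (nz_indices f)"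
  have "successively (\<lambda>r r'. (coeff f (hd r) > 0) \<noteq> (coeff f (hd r') > 0)) ?rs"
    using split_runs_alternate[of "coeff f" "nz_indices f"]
    by (rule successively_mono) (use coeff_hd_run_nonzero[of _ f] in \<open>auto simp: sgn_if split: if_splits\<close>)
  moreover obtain xs where "nz_indices f = degree f # xs"
    using assms nz_indices_Cons[of f] by fastforce
  then have "coeff f (hd (hd ?rs)) > 0"
    using assms by simp
  ultimately show "length (neg_runs f) \<le> length (pos_runs f)"
    and "\<And>j p q. j < length (neg_runs f) \<Longrightarrow> p \<in> set (pos_runs f ! j) \<Longrightarrow> q \<in> set (neg_runs f ! j) \<Longrightarrow> q < p"
    using filter_alternating[OF _ _ sorted_split_runs_nz_indices, of "\<lambda>r. coeff f (hd r) > 0" f]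
    unfolding pos_runs_def neg_runs_alt by blast+
qed

lemma length_neg_runs_le:
  assumes "coeff f (degree f) > 0"
  shows "length (neg_runs f) \<le> sign_changes f div 2 + 1"
proof -
  let ?rs = "split_runs (coeff f) (nz_indices f)"
  have "nz_indices f \<noteq> []"
    using assms nz_indices_Cons[of f] by fastforce
  then have "length ?rs = Suc (sign_changes f)"
    unfolding sign_changes_def by (rule length_split_runs) (simp add: set_nz_indices)
  moreover have "length (pos_runs f) + length (neg_runs f) = length ?rs"
    unfolding pos_runs_def neg_runs_alt by (rule sum_length_filter_compl)
  ultimately show ?thesis
    using pos_neg_runs_alternate(1)[OF assms] by linarith
qed

text \<open>Any other run lies entirely above or entirely below \<open>r\<close>, because the runs
  are ordered by decreasing index.\<close>

lemma split_runs_nz_convex: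
  assumes r: "r \<in> set (split_runs (coeff f) (nz_indices f))"
    and i: "coeff f i \<noteq> 0" "Min (set r) \<le> i" "i \<le> Max (set r)"
  shows "i \<in> set r"
proof -
  let ?rs = "split_runs (coeff f) (nz_indices f)"
  note srt = sorted_split_runs_nz_indices[of f]
  have "i \<in> set (concat ?rs)"
    using i by (simp add: concat_split_runs set_nz_indices)
  then obtain r' where r': "r' \<in> set ?rs" "i \<in> set r'" by auto
  obtain k l where kl: "k < length ?rs" "?rs ! k = r" "l < length ?rs" "?rs ! l = r'"
    using r r'(1) by (metis in_set_conv_nth)
  have "r \<noteq> []" using split_runs_nonempty[OF r] .
  then have ends: "Min (set r) \<in> set r" "Max (set r) \<in> set r" by auto
  consider "k < l" | "l < k" | "k = l" by linarith
  then show ?thesis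
  proof cases
    case 1
    then have "Min (set r) > i"
      using sorted_wrt_nth_less[OF srt, of k l] kl ends r'(2) by auto
    then show ?thesis using i by simp
  next
    case 2
    then have "Max (set r) < i"
      using sorted_wrt_nth_less[OF srt, of l k] kl ends r'(2) by auto
    then show ?thesis using i by simp
  next
    case 3
    then show ?thesis using kl r' by simp
  qed
qed

text \<open>This reconciles the interval sums in \<open>pos_sum\<close> and \<open>neg_sum\<close>
  with sums over a run: the additional indices carry zero coefficients.\<close>

lemma sum_abs_run:
  assumes r: "r \<in> set (split_runs (coeff f) (nz_indices f))"
  shows "(\<Sum>i = Min (set r)..Max (set r). \<bar>coeff f i\<bar>) = (\<Sum>i\<in>set r. \<bar>coeff f i\<bar>)"
proof (rule sum.mono_neutral_right)
  show "\<forall>i\<in>{Min (set r)..Max (set r)} - set r. \<bar>coeff f i\<bar> = 0"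
    using split_runs_nz_convex[OF r] by fastforce
qed auto

text \<open>The sum is regrouped by runs. \<open>block_nonneg\<close> lets each positive run absorb
  the negative run of the same number; a positive run without partner contributes a nonnegative
  amount.\<close>

lemma taylor_coeff_nonneg:
  fixes f :: "real poly" and v :: real
  assumes lc: "coeff f (degree f) > 0" and v1: "v \<ge> 1"
    and bound: "\<And>j. 1 \<le> j \<Longrightarrow> j \<le> length (neg_runs f) \<Longrightarrow> run_bound f j \<le> v"
  shows "(\<Sum>i\<le>degree f. coeff f i * (real (i choose m) * v ^ (i - m))) \<ge> 0"
proof -
  define c where "c i = real (i choose m) * v ^ (i - m)" for i
  define rs where "rs = split_runs (coeff f) (nz_indices f)"
  \<comment> \<open>\<open>F r\<close> is the contribution of the run \<open>r\<close> to the m-th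
    Taylor coefficient at \<open>v\<close>.\<close>
  define F where "F r = (\<Sum>i\<leftarrow>r. coeff f i * c i)" for r
  have c_nonneg: "c i \<ge> 0" for i unfolding c_def using v1 by simp
  have pr: "pos_runs f = filter (\<lambda>r. coeff f (hd r) > 0) rs"
    by (simp add: pos_runs_def rs_def)
  have nr: "neg_runs f = filter (\<lambda>r. \<not> coeff f (hd r) > 0) rs"
    by (simp add: neg_runs_alt rs_def)
  note alternate = pos_neg_runs_alternate[OF lc]
  have dist: "distinct r" if "r \<in> set rs" for r
  proof -
    have "distinct (concat rs)"
      by (simp add: rs_def concat_split_runs distinct_nz_indices)
    then show ?thesis using that by (simp add: distinct_concat_iff)
  qed
  have pos_F: "F r \<ge> 0" if "r \<in> set (pos_runs f)" for r
    unfolding F_def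
  proof (rule sum_list_nonneg)
    fix y assume "y \<in> set (map (\<lambda>i. coeff f i * c i) r)"
    then obtain i where i: "i \<in> set r" "y = coeff f i * c i" by auto
    have "sgn (coeff f i) = 1"
      using that i split_runs_same_sgn[of r "coeff f" "nz_indices f" i] by (auto simp: pr rs_def)
    then show "y \<ge> 0" using i c_nonneg by (auto simp: sgn_if split: if_splits)
  qed
  have pair_F: "F (pos_runs f ! j) + F (neg_runs f ! j) \<ge> 0" if j: "j < length (neg_runs f)" for j
  proof -
    let ?p = "pos_runs f ! j" and ?q = "neg_runs f ! j"
    have "?p \<in> set (pos_runs f)" "?q \<in> set (neg_runs f)"
      using j alternate(1) by auto
    then have p: "?p \<in> set rs" "coeff f (hd ?p) > 0" and q: "?q \<in> set rs" "coeff f (hd ?q) < 0"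
      using coeff_hd_run_nonzero[of ?q f] by (auto simp: pr nr rs_def)
    \<comment> \<open>List position \<open>j\<close> is run number \<open>Suc j\<close>, as runs are
      numbered from 1.\<close>
    have sums: "pos_sum f (Suc j) = (\<Sum>i\<in>set ?p. \<bar>coeff f i\<bar>)"
      "neg_sum f (Suc j) = (\<Sum>i\<in>set ?q. \<bar>coeff f i\<bar>)"
      using sum_abs_run[of ?p f] sum_abs_run[of ?q f] p q j
      by (simp_all add: pos_sum_def neg_sum_def pos_lo_def pos_hi_def neg_lo_def neg_hi_def rs_def)
    have "(\<Sum>i\<in>set ?p. coeff f i * c i) + (\<Sum>i\<in>set ?q. coeff f i * c i) \<ge> 0"
      unfolding c_def
    proof (rule block_nonneg)
      show "set ?p \<noteq> {}" "set ?q \<noteq> {}"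
        using p q split_runs_nonempty[of _ "coeff f" "nz_indices f"] by (auto simp: rs_def)
      show "coeff f i > 0" if "i \<in> set ?p" for i
        using split_runs_same_sgn[of ?p "coeff f" "nz_indices f" i] that p
        by (auto simp: rs_def sgn_if split: if_splits)
      show "coeff f i < 0" if "i \<in> set ?q" for i
        using split_runs_same_sgn[of ?q "coeff f" "nz_indices f" i] that q
        by (auto simp: rs_def sgn_if split: if_splits)
      show "i' < i" if "i \<in> set ?p" "i' \<in> set ?q" for i i'
        using alternate(2) j that by blast
      fix i assume i: "i \<in> set ?q"
      let ?g = "\<lambda>i. (neg_sum f (Suc j) / pos_sum f (Suc j)) powr (1 / (real (pos_lo f (Suc j)) - real i))"
      have "?g i \<le> Max (?g ` {neg_lo f (Suc j)..neg_hi f (Suc j)})"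
        using i by (intro Max_ge) (auto simp: neg_lo_def neg_hi_def)
      also have "\<dots> \<le> run_bound f (Suc j)"
        using j by (simp add: run_bound_def)
      also have "\<dots> \<le> v"
        using j by (intro bound) auto
      finally show "((\<Sum>i\<in>set ?q. \<bar>coeff f i\<bar>) / (\<Sum>i\<in>set ?p. \<bar>coeff f i\<bar>)) powr
          (1 / (real (Min (set ?p)) - real i)) \<le> v"
        by (simp add: sums pos_lo_def)
    qed (use v1 in auto)
    then show ?thesis
      using dist p q by (simp add: F_def sum_list_distinct_conv_sum_set)
  qed

  have "0 \<le> (\<Sum>j<length (neg_runs f). F (pos_runs f ! j) + F (neg_runs f ! j))"
    by (intro sum_nonneg pair_F) auto
  also have "\<dots> = (\<Sum>j<length (neg_runs f). F (pos_runs f ! j)) + (\<Sum>r\<leftarrow>neg_runs f. F r)"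
    by (simp add: sum.distrib sum_list_sum_nth atLeast0LessThan)
  \<comment> \<open>Any positive run left without a partner is added here.\<close>
  also have "\<dots> \<le> (\<Sum>j<length (pos_runs f). F (pos_runs f ! j)) + (\<Sum>r\<leftarrow>neg_runs f. F r)"
    using alternate(1) by (intro add_right_mono sum_mono2) (auto intro: pos_F)
  also have "\<dots> = (\<Sum>r\<leftarrow>pos_runs f. F r) + (\<Sum>r\<leftarrow>neg_runs f. F r)"
    by (simp add: sum_list_sum_nth atLeast0LessThan)
  also have "\<dots> = (\<Sum>r\<leftarrow>rs. F r)"
    unfolding pr nr by (rule sum_list_filter_split[symmetric])
  also have "\<dots> = (\<Sum>i\<leftarrow>concat rs. coeff f i * c i)"
    unfolding F_def by (induction rs) auto
  also have "\<dots> = (\<Sum>i | coeff f i \<noteq> 0. coeff f i * c i)"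
    using distinct_nz_indices[of f]
    by (simp add: rs_def concat_split_runs sum_list_distinct_conv_sum_set set_nz_indices)
  also have "\<dots> = (\<Sum>i\<le>degree f. coeff f i * c i)"
    by (intro sum.mono_neutral_left) (auto intro: le_degree)
  finally show ?thesis by (simp add: c_def)
qed

section \<open>The zero-free sector\<close>

theorem theorem2p12:
  fixes f :: "real poly" and n s :: nat and v :: real
  assumes "degree f = n" and "n \<ge> 1" and "coeff f n > 0"
    and "sign_changes f = s" and "s \<ge> 1"
    and "v = Max (run_bound f ` {1..s div 2 + 1})"
  shows "\<forall>z \<in> sector v (pi / real n). poly (map_poly complex_of_real f) z \<noteq> 0"
proof
  fix z assume "z \<in> sector v (pi / real n)"
  then obtain \<rho> \<phi> where \<rho>: "\<rho> > 0" and \<phi>: "\<bar>\<phi>\<bar> < pi / real n"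
    and z: "z = complex_of_real v + complex_of_real \<rho> * exp (\<i> * complex_of_real \<phi>)"
    by (auto simp: sector_def)
  define b where "b m = (\<Sum>i\<le>degree f. coeff f i * (real (i choose m) * v ^ (i - m)))" for m
  have bound: "run_bound f j \<le> v" if "1 \<le> j" "j \<le> s div 2 + 1" for j
    using that assms(6) by auto
  \<comment> \<open>Both branches of \<open>run_bound\<close> are at least 1, and 1 always lies in
    the index range of the maximum, so v \<ge> 1.\<close>
  have "1 \<le> run_bound f 1"
    by (simp add: run_bound_def)
  also have "\<dots> \<le> v"
    by (rule bound) auto
  finally have "b m \<ge> 0" for m
    unfolding b_def using assms length_neg_runs_le[of f]
    by (intro taylor_coeff_nonneg bound) auto
  moreover have "b n > 0"
  proof -
    \<comment> \<open>For i < n the factor \<open>i choose n\<close> is zero, so only the leading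
      coefficient survives.\<close>
    have "b n = (\<Sum>i\<in>{n}. coeff f i * (real (i choose n) * v ^ (i - n)))"
      unfolding b_def using assms(1) by (intro sum.mono_neutral_right) (auto simp: binomial_eq_0)
    then show ?thesis using assms by simp
  qed
  ultimately have "(\<Sum>m\<le>n. complex_of_real (b m) * (complex_of_real \<rho> * exp (\<i> * complex_of_real \<phi>)) ^ m) \<noteq> 0"
    using assms(2) \<rho> \<phi> by (intro sector_sum_nonzero) auto
  then show "poly (map_poly complex_of_real f) z \<noteq> 0"
    by (simp add: z poly_of_real_offset b_def assms(1))
qed

end
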